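(* Let $\Phi^N=\{\varphi_1,\dots,\varphi_N\}\subset X$ be a reduced basis constructed by the greedy procedure described in the context for an error tolerance $\varepsilon>0$. Let $\bar\Phi^N\in\mathcal{L}(\mathbb{R}^N,X)$ be the operator given on the $i$-th unit vector $e_i\in\mathbb{R}^N$ by $\bar\Phi^N e_i=\varphi_i$, $i=1,\dots,N$. Let $\hat\pi_N\colon\mathcal{P}\to\mathbb{R}^N$ be an approximation of the exact parameter-to-coefficients map $\pi_N\colon\mathcal{P}\to\mathbb{R}^N$ (i.e. an arbitrary map), and let $\hat\varphi_\mu^N:=\sum_{i=1}^N[\hat\pi_N(\mu)]_i\,\varphi_i$. Then $$\|\varphi_\mu^*(T)-\hat\varphi_\mu^N\|\;\le\;C_\Lambda\varepsilon+\|\bar\Phi^N\|_{\mathcal{L}(\mathbb{R}^N,X)}\,\|\pi_N(\mu)-\hat\pi_N(\mu)\|$$ for all parameters $\mu\in\mathcal{P}$.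
   Context: $X\neq\{0\}$ and $U$ are real Hilbert spaces (possibly infinite-dimensional), and $\mathcal{L}(V,W)$ denotes the bounded linear operators from $V$ to $W$; $I$ is the identity on $X$; norms without index are those of $X$, of $\mathbb{R}^N$ (Euclidean), or of the Banach space containing $\mathcal{P}$, as appropriate. $T>0$ is a final time. $\mathcal{P}$ is a nonempty compact subset of a Banach space. For each $\mu\in\mathcal{P}$ we are given $A_\mu\in\mathcal{L}(X,X)$, $B_\mu\in\mathcal{L}(U,X)$, an initial state $x_\mu^0\in X$ and a target state $x_\mu^T\in X$; the four maps $\mu\mapsto A_\mu,\ B_\mu,\ x_\mu^0,\ x_\mu^T$ are Lipschitz continuous on $\mathcal{P}$. $M\in\mathcal{L}(X,X)$ is self-adjoint and positive-semidefinite; $R\in\mathcal{L}(U,U)$ is self-adjoint with $R\ge\alpha I$ for some $\alpha>0$. $A^*$ denotes the Hilbert space adjoint. The weighted controllability Gramian is $$\Lambda_\mu^R:=\int_0^T e^{A_\mu(T-s)}B_\mu R^{-1}B_\mu^*e^{A_\mu^*(T-s)}\,ds\in\mathcal{L}(X,X).$$ Standing assumption: for all $\mu\in\mathcal{P}$ the operator $M\Lambda_\mu^R$ is positive-semidefinite, i.e. $\langle M\Lambda_\mu^R p,p\rangle\ge 0$ for all $p\in X$. The optimal final time adjoint $\varphi_\mu^*(T)\in X$ is the value at time $T$ of the adjoint state of the optimality system $\dot x=A_\mu x+B_\mu u$, $-\dot\varphi=A_\mu^*\varphi$, $u=-R^{-1}B_\mu^*\varphi$ on $[0,T]$, $x(0)=x_\mu^0$,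 $\varphi(T)=M(x(T)-x_\mu^T)$; equivalently, it is the solution of $(I+M\Lambda_\mu^R)\varphi_\mu^*(T)=M(e^{A_\mu T}x_\mu^0-x_\mu^T)$. The error estimator is $\eta_\mu(p):=\|M(e^{A_\mu T}x_\mu^0-x_\mu^T)-(I+M\Lambda_\mu^R)p\|$ for $p\in X$. Constants: since $\mathcal{P}$ is compact, the four maps $\mu\mapsto A_\mu,\ B_\mu,\ x_\mu^0,\ x_\mu^T$ are Lipschitz continuous on $\mathcal{P}$, and $M\Lambda_\mu^R$ is positive-semidefinite for all $\mu\in\mathcal{P}$, the map $\mathcal{P}\ni\mu\mapsto\varphi_\mu^*(T)\in X$ is Lipschitz continuous; $C_{\varphi^*}\ge 0$ denotes its Lipschitz constant, so that $\|\varphi_\mu^*(T)-\varphi_{\tilde\mu}^*(T)\|\le C_{\varphi^*}\|\mu-\tilde\mu\|$ for all $\mu,\tilde\mu\in\mathcal{P}$. Moreover $C_\Lambda:=\sup_{\mu\in\mathcal{P}}\|I+M\Lambda_\mu^R\|_{\mathcal{L}(X,X)}<\infty$, with $C_\Lambda\ge1$, and $\gamma:=\frac{1}{C_{\varphi^*}+C_\Lambda}$. Coefficients and approximate adjoints: given linearly independent $\varphi_1,\dots,\varphi_k\in X$ and $\mu\in\mathcal{P}$, let $x_i^\mu:=(I+M\Lambda_\mu^R)\varphi_i$ ($i=1,\dots,k$; these are linearly independent), and let $\alpha^\mu\in\mathbb{R}^k$ be the coefficients such that $\sum_{i=1}^k\alpha_i^\mu x_i^\mu$ is the orthogonal projection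 of $M(e^{A_\mu T}x_\mu^0-x_\mu^T)$ onto $\operatorname{span}(x_1^\mu,\dots,x_k^\mu)$ (equivalently, $\alpha^\mu$ solves $\bar X_\mu^*\bar X_\mu\alpha^\mu=\bar X_\mu^*M(e^{A_\mu T}x_\mu^0-x_\mu^T)$ with $\bar X_\mu=[x_1^\mu\cdots x_k^\mu]\in\mathcal{L}(\mathbb{R}^k,X)$). Set $\tilde\varphi_\mu^k:=\sum_{i=1}^k\alpha_i^\mu\varphi_i$. For the final basis ($k=N$) the parameter-to-coefficients map is $\pi_N(\mu):=\alpha^\mu\in\mathbb{R}^N$, $\mu\in\mathcal{P}$. Greedy procedure (input: $\varepsilon>0$): 1. Set $\tilde\varepsilon:=C_\Lambda\gamma\varepsilon$ and $\delta:=\tilde\varepsilon/C_\Lambda$. Choose a finite training set $\mathcal{P}_{\mathrm{train}}\subset\mathcal{P}$ such that for every $\mu\in\mathcal{P}$ there is $\tilde\mu\in\mathcal{P}_{\mathrm{train}}$ with $\|\mu-\tilde\mu\|\le\delta$. 2. Set $k:=0$, $\Phi^0:=\emptyset$, $\tilde\varphi_\mu^0:=0$ for all $\mu\in\mathcal{P}_{\mathrm{train}}$, and choose $\mu_1\in\operatorname{argmax}_{\mu\in\mathcal{P}_{\mathrm{train}}}\eta_\mu(\tilde\varphi_\mu^0)$. 3. While $\eta_{\mu_{k+1}}(\tilde\varphi_{\mu_{k+1}}^k)>\tilde\varepsilon$: set $\varphi_{k+1}:=\varphi_{\mu_{k+1}}^*(T)$, $\Phi^{k+1}:=\Phi^k\cup\{\varphi_{k+1}\}$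 (optionally replacing $\varphi_{k+1}$ by its Gram–Schmidt orthonormalization against $\Phi^k$, which does not change the span), increase $k$ by one, compute $\tilde\varphi_\mu^k$ for all $\mu\in\mathcal{P}_{\mathrm{train}}$, and choose $\mu_{k+1}\in\operatorname{argmax}_{\mu\in\mathcal{P}_{\mathrm{train}}}\eta_\mu(\tilde\varphi_\mu^k)$. 4. Upon termination, return $\Phi^N:=\Phi^k$. *)

theory Defs
  imports "HOL-Analysis.Analysis"
begin

section \<open>Operators on real Hilbert spaces\<close>

text \<open>A real Hilbert space is a type of sort \<open>{real_inner, banach}\<close>.\<close>

definition blinfun_adjoint ::
    "('a::{real_inner,banach} \<Rightarrow>\<^sub>L 'b::{real_inner,banach}) \<Rightarrow> 'b \<Rightarrow>\<^sub>L 'a" where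
  "blinfun_adjoint F = Blinfun (adjoint (blinfun_apply F))"

definition blinfun_inv ::
    "('a::real_normed_vector \<Rightarrow>\<^sub>L 'b::real_normed_vector) \<Rightarrow> 'b \<Rightarrow>\<^sub>L 'a" where
  "blinfun_inv F = Blinfun (inv (blinfun_apply F))"

text \<open>The library constant \<open>exp\<close> is not available on the type of bounded operators, which is not an
  instance of \<open>real_normed_algebra_1\<close>.\<close>

definition blinfun_exp :: "('a::banach \<Rightarrow>\<^sub>L 'a) \<Rightarrow> 'a \<Rightarrow>\<^sub>L 'a" where
  "blinfun_exp F = (\<Sum>n. (((o\<^sub>L) F) ^^ n) id_blinfun /\<^sub>R fact n)"

definition self_adjoint :: "('a::{real_inner,banach} \<Rightarrow>\<^sub>L 'a) \<Rightarrow> bool" where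
  "self_adjoint F \<longleftrightarrow> blinfun_adjoint F = F"

text \<open>This is the condition on the quadratic form only; symmetry is not included.\<close>

definition positive_semidefinite :: "('a::{real_inner,banach} \<Rightarrow>\<^sub>L 'a) \<Rightarrow> bool" where
  "positive_semidefinite F \<longleftrightarrow> (\<forall>p. 0 \<le> inner (F p) p)"

text \<open>Orthogonal projection of \<open>y\<close> onto a closed subspace \<open>S\<close>.\<close>

definition orth_proj :: "'a::real_inner set \<Rightarrow> 'a \<Rightarrow> 'a" where
  "orth_proj S y = (THE w. w \<in> S \<and> (\<forall>v\<in>S. orthogonal (y - w) v))"

text \<open>Gram--Schmidt orthonormalization of \<open>p\<close> against \<open>S\<close>, which need not itself be orthonormal.\<close>

definition gram_schmidt_step :: "'a::real_inner set \<Rightarrow> 'a \<Rightarrow> 'a" where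
  "gram_schmidt_step S p =
    (p - orth_proj (span S) p) /\<^sub>R norm (p - orth_proj (span S) p)"

section \<open>Coefficient vectors\<close>

text \<open>A vector of \<open>\<real>\<^sup>N\<close> is represented by a function \<open>nat \<Rightarrow> real\<close> of which only the entries
  with index in \<open>{1..N}\<close> are relevant, since the dimension is the (possibly zero) number of
  steps of an algorithm. The Euclidean norm is then \<open>L2_set v {1..N}\<close>.\<close>

definition lin_comb :: "nat \<Rightarrow> (nat \<Rightarrow> 'a::real_vector) \<Rightarrow> (nat \<Rightarrow> real) \<Rightarrow> 'a" where
  "lin_comb N \<phi> v = (\<Sum>i=1..N. v i *\<^sub>R \<phi> i)"

text \<open>Norm of the operator \<open>\<real>\<^sup>N \<rightarrow> X\<close> mapping the \<open>i\<close>-th unit vector to \<open>\<phi> i\<close>,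
  in the same form as the library's \<open>onorm\<close>.\<close>

definition lin_comb_onorm :: "nat \<Rightarrow> (nat \<Rightarrow> 'a::real_normed_vector) \<Rightarrow> real" where
  "lin_comb_onorm N \<phi> = (SUP v. norm (lin_comb N \<phi> v) / L2_set v {1..N})"

section \<open>Parametrized linear-quadratic optimal control\<close>

record (overloaded) ('p, 'x, 'u) lq_problem =
  horizon :: real
  state_op :: "'p \<Rightarrow> 'x::{real_inner,banach} \<Rightarrow>\<^sub>L 'x"
  control_op :: "'p \<Rightarrow> 'u::{real_inner,banach} \<Rightarrow>\<^sub>L 'x"
  init_state :: "'p \<Rightarrow> 'x"
  target_state :: "'p \<Rightarrow> 'x"
  final_weight :: "'x \<Rightarrow>\<^sub>L 'x"
  control_weight :: "'u \<Rightarrow>\<^sub>L 'u"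

definition gramian ::
    "('p, 'x::{real_inner,banach}, 'u::{real_inner,banach}) lq_problem \<Rightarrow> 'p \<Rightarrow> 'x \<Rightarrow>\<^sub>L 'x" where
  "gramian D \<mu> = integral {0..horizon D} (\<lambda>s.
      blinfun_exp ((horizon D - s) *\<^sub>R state_op D \<mu>)
      o\<^sub>L control_op D \<mu>
      o\<^sub>L blinfun_inv (control_weight D)
      o\<^sub>L blinfun_adjoint (control_op D \<mu>)
      o\<^sub>L blinfun_exp ((horizon D - s) *\<^sub>R blinfun_adjoint (state_op D \<mu>)))"

text \<open>The operator \<open>I + M \<Lambda>\<close> and the right-hand side \<open>M (e\<^sup>A\<^sup>T x\<^sup>0 - x\<^sup>T)\<close> of the linear system
  characterizing the optimal final time adjoint.\<close>

definition system_op ::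
    "('p, 'x::{real_inner,banach}, 'u::{real_inner,banach}) lq_problem \<Rightarrow> 'p \<Rightarrow> 'x \<Rightarrow>\<^sub>L 'x" where
  "system_op D \<mu> = id_blinfun + (final_weight D o\<^sub>L gramian D \<mu>)"

definition system_rhs ::
    "('p, 'x::{real_inner,banach}, 'u::{real_inner,banach}) lq_problem \<Rightarrow> 'p \<Rightarrow> 'x" where
  "system_rhs D \<mu> = final_weight D
     (blinfun_exp (horizon D *\<^sub>R state_op D \<mu>) (init_state D \<mu>) - target_state D \<mu>)"

definition optimality_system ::
    "('p, 'x::{real_inner,banach}, 'u::{real_inner,banach}) lq_problem \<Rightarrow> 'p \<Rightarrow>
     (real \<Rightarrow> 'x) \<Rightarrow> (real \<Rightarrow> 'x) \<Rightarrow> (real \<Rightarrow> 'u) \<Rightarrow> bool" where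
  "optimality_system D \<mu> x \<phi> u \<longleftrightarrow>
     (\<forall>t\<in>{0..horizon D}.
        (x has_vector_derivative (state_op D \<mu> (x t) + control_op D \<mu> (u t)))
          (at t within {0..horizon D}) \<and>
        (\<phi> has_vector_derivative - blinfun_adjoint (state_op D \<mu>) (\<phi> t))
          (at t within {0..horizon D}) \<and>
        u t = - blinfun_inv (control_weight D) (blinfun_adjoint (control_op D \<mu>) (\<phi> t))) \<and>
     x 0 = init_state D \<mu> \<and>
     \<phi> (horizon D) = final_weight D (x (horizon D) - target_state D \<mu>)"

definition final_adjoint ::
    "('p, 'x::{real_inner,banach}, 'u::{real_inner,banach}) lq_problem \<Rightarrow> 'p \<Rightarrow> 'x" where
  "final_adjoint D \<mu> = (THE p. \<exists>x \<phi> u. optimality_system D \<mu> x \<phi> u \<and> \<phi> (horizon D) = p)"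

definition error_estimator ::
    "('p, 'x::{real_inner,banach}, 'u::{real_inner,banach}) lq_problem \<Rightarrow> 'p \<Rightarrow> 'x \<Rightarrow> real" where
  "error_estimator D \<mu> p = norm (system_rhs D \<mu> - system_op D \<mu> p)"

definition system_bound ::
    "'p set \<Rightarrow> ('p, 'x::{real_inner,banach}, 'u::{real_inner,banach}) lq_problem \<Rightarrow> real" where
  "system_bound P D = (SUP \<mu>\<in>P. norm (system_op D \<mu>))"

section \<open>Reduced basis and greedy procedure\<close>

definition coefficients ::
    "('p, 'x::{real_inner,banach}, 'u::{real_inner,banach}) lq_problem \<Rightarrow>
     nat \<Rightarrow> (nat \<Rightarrow> 'x) \<Rightarrow> 'p \<Rightarrow> nat \<Rightarrow> real" where
  "coefficients D k \<phi> \<mu> = (THE a. (\<forall>i. i \<notin> {1..k} \<longrightarrow> a i = 0) \<and>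
     lin_comb k (\<lambda>i. system_op D \<mu> (\<phi> i)) a =
       orth_proj (span ((\<lambda>i. system_op D \<mu> (\<phi> i)) ` {1..k})) (system_rhs D \<mu>))"

definition approx_adjoint ::
    "('p, 'x::{real_inner,banach}, 'u::{real_inner,banach}) lq_problem \<Rightarrow>
     nat \<Rightarrow> (nat \<Rightarrow> 'x) \<Rightarrow> 'p \<Rightarrow> 'x" where
  "approx_adjoint D k \<phi> \<mu> = lin_comb k \<phi> (coefficients D k \<phi> \<mu>)"

text \<open>\<open>greedy_basis P D C \<epsilon> N \<phi>\<close>: some run of the greedy procedure with tolerance \<open>\<epsilon>\<close> terminates
  after exactly \<open>N\<close> steps with the basis \<open>\<phi> 1, \<dots>, \<phi> N\<close>; \<open>C\<close> is the Lipschitz constant of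
  \<open>final_adjoint D\<close> on \<open>P\<close>. Each step is free to orthonormalize the new basis element or
  not.\<close>

definition greedy_basis ::
    "'p::real_normed_vector set \<Rightarrow>
     ('p, 'x::{real_inner,banach}, 'u::{real_inner,banach}) lq_problem \<Rightarrow>
     real \<Rightarrow> real \<Rightarrow> nat \<Rightarrow> (nat \<Rightarrow> 'x) \<Rightarrow> bool" where
  "greedy_basis P D C \<epsilon> N \<phi> \<longleftrightarrow>
    (let C\<^sub>\<Lambda> = system_bound P D;
         \<gamma> = 1 / (C + C\<^sub>\<Lambda>);
         tol = C\<^sub>\<Lambda> * \<gamma> * \<epsilon>;
         \<delta> = tol / C\<^sub>\<Lambda>;
         \<eta> = (\<lambda>k \<mu>. error_estimator D \<mu> (approx_adjoint D k \<phi> \<mu>))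
     in \<exists>Q m.
       finite Q \<and> Q \<subseteq> P \<and>
       (\<forall>\<mu>\<in>P. \<exists>\<nu>\<in>Q. norm (\<mu> - \<nu>) \<le> \<delta>) \<and>
       (\<forall>k\<le>N. is_arg_max (\<eta> k) (\<lambda>\<mu>. \<mu> \<in> Q) (m (Suc k))) \<and>
       (\<forall>k<N. \<eta> k (m (Suc k)) > tol \<and>
          (\<phi> (Suc k) = final_adjoint D (m (Suc k)) \<or>
           \<phi> (Suc k) = gram_schmidt_step (\<phi> ` {1..k}) (final_adjoint D (m (Suc k))))) \<and>
       \<eta> N (m (Suc N)) \<le> tol)"

end

theory Submission
  imports Defs
begin

text \<open>
  Write \<open>S\<^sub>\<mu> = I + M \<Lambda>\<^sub>\<mu>\<close> for the system operator and \<open>p\<^sub>\<mu>\<close> for the optimal final adjoint. The estimate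
  rests on three facts.

  \<^item> \<open>p\<^sub>\<mu>\<close> solves \<open>S\<^sub>\<mu> p = b\<^sub>\<mu>\<close>, where \<open>b\<^sub>\<mu>\<close> is the right-hand side
    (\<open>system_op_final_adjoint\<close>). Since \<open>M \<Lambda>\<^sub>\<mu>\<close> is positive semidefinite,
    \<open>\<parallel>q\<parallel> \<le> \<parallel>S\<^sub>\<mu> q\<parallel> \<le> C\<^sub>\<Lambda> \<parallel>q\<parallel>\<close>, so the residual of \<open>q\<close> lies between \<open>\<parallel>p\<^sub>\<mu> - q\<parallel>\<close> and
    \<open>C\<^sub>\<Lambda> \<parallel>p\<^sub>\<mu> - q\<parallel>\<close> (\<open>error_estimator_bounds\<close>).
  \<^item> The approximate adjoint at \<open>\<mu>\<close> has the least residual among all elements of the reduced space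
    (\<open>approx_adjoint_minimizes_error_estimator\<close>). This needs a linearly independent basis, for
    otherwise the coefficients are not determined; the greedy loop yields such a basis because it only
    adds an adjoint that the current space misses (\<open>greedy_family_lin_indep\<close>).
  \<^item> Every \<open>\<mu>\<close> is within \<open>\<delta> = \<gamma> \<epsilon>\<close> of a training parameter \<open>\<nu>\<close>, whose approximate adjoint \<open>q\<close>
    satisfies \<open>\<parallel>p\<^sub>\<nu> - q\<parallel> \<le> C\<^sub>\<Lambda> \<gamma> \<epsilon>\<close> on termination.

  By Lipschitz continuity \<open>\<parallel>p\<^sub>\<mu> - q\<parallel> \<le> C \<gamma> \<epsilon> + C\<^sub>\<Lambda> \<gamma> \<epsilon> = \<epsilon>\<close>. The element \<open>q\<close> competes with the
  approximate adjoint at \<open>\<mu>\<close>, whose residual, and hence whose error, is therefore at most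
  \<open>C\<^sub>\<Lambda> \<epsilon>\<close>. Replacing the exact coefficients by approximate ones adds the second term.

  The analytic work lies in the first fact. The optimality system is solved by variation of
  constants, for which the exponential of a bounded operator is differentiated; the linear system is
  solved by the Lax--Milgram theorem; and \<open>C\<^sub>\<Lambda>\<close> is a finite supremum because the Gramian is bounded
  uniformly in \<open>\<mu>\<close>, which requires \<open>\<parallel>F\<^sup>*\<parallel> \<le> \<parallel>F\<parallel>\<close> and therefore the Riesz representation theorem.
\<close>

section \<open>The exponential of a bounded operator\<close>

abbreviation blinfun_power :: "('a::real_normed_vector \<Rightarrow>\<^sub>L 'a) \<Rightarrow> nat \<Rightarrow> 'a \<Rightarrow>\<^sub>L 'a" where
  "blinfun_power F n \<equiv> (((o\<^sub>L) F) ^^ n) id_blinfun"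

lemma blinfun_compose_assoc: "(F o\<^sub>L G) o\<^sub>L H = F o\<^sub>L (G o\<^sub>L H)"
  by (rule blinfun_eqI) simp

lemma norm_blinfun_power_le: "norm (blinfun_power F n) \<le> norm F ^ n"
proof (induction n)
  case (Suc n)
  have "norm (blinfun_power F (Suc n)) \<le> norm F * norm (blinfun_power F n)"
    by (simp add: norm_blinfun_compose)
  also have "\<dots> \<le> norm F * norm F ^ n"
    using Suc by (intro mult_left_mono) auto
  finally show ?case by simp
qed (simp add: norm_blinfun_id_le)

lemma blinfun_power_scaleR: "blinfun_power (t *\<^sub>R F) n = t ^ n *\<^sub>R blinfun_power F n"
  by (induction n) (auto intro!: blinfun_eqI simp: blinfun.bilinear_simps)

lemma blinfun_power_commute: "blinfun_power F n o\<^sub>L F = F o\<^sub>L blinfun_power F n"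
proof (induction n)
  case 0
  show ?case by (rule blinfun_eqI) simp
qed (simp add: blinfun_compose_assoc)

lemma norm_blinfun_exp_term_le:
  "norm (blinfun_power F n /\<^sub>R fact n) \<le> norm F ^ n /\<^sub>R fact n"
  by (simp add: norm_blinfun_power_le)

lemma summable_blinfun_exp:
  fixes F :: "'a::banach \<Rightarrow>\<^sub>L 'a"
  shows "summable (\<lambda>n. blinfun_power F n /\<^sub>R fact n)"
  by (rule summable_comparison_test'[where g = "\<lambda>n. norm F ^ n /\<^sub>R fact n"])
     (rule summable_exp_generic norm_blinfun_exp_term_le)+

lemma norm_blinfun_exp_le:
  fixes F :: "'a::banach \<Rightarrow>\<^sub>L 'a"
  shows "norm (blinfun_exp F) \<le> exp (norm F)"
  unfolding blinfun_exp_def exp_def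
  by (intro norm_suminf_le norm_blinfun_exp_term_le summable_exp_generic)

lemma blinfun_exp_0 [simp]: "blinfun_exp 0 = id_blinfun"
proof -
  have "blinfun_power (0::'a::banach \<Rightarrow>\<^sub>L 'a) n = (if n = 0 then id_blinfun else 0)" for n
    by (cases n) auto
  then have "blinfun_exp (0::'a \<Rightarrow>\<^sub>L 'a) = (\<Sum>n. if n = 0 then id_blinfun else 0)"
    unfolding blinfun_exp_def by (intro suminf_cong) auto
  then show ?thesis
    using suminf_finite[of "{0::nat}" "\<lambda>n. if n = 0 then id_blinfun else (0::'a \<Rightarrow>\<^sub>L 'a)"] by simp
qed

lemma blinfun_exp_commute:
  fixes F :: "'a::banach \<Rightarrow>\<^sub>L 'a"
  shows "blinfun_exp (t *\<^sub>R F) o\<^sub>L F = F o\<^sub>L blinfun_exp (t *\<^sub>R F)"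
proof -
  have s: "summable (\<lambda>n. blinfun_power (t *\<^sub>R F) n /\<^sub>R fact n)"
    by (rule summable_blinfun_exp)
  have "blinfun_exp (t *\<^sub>R F) o\<^sub>L F = (\<Sum>n. (blinfun_power (t *\<^sub>R F) n /\<^sub>R fact n) o\<^sub>L F)"
    unfolding blinfun_exp_def
    by (rule bounded_linear.suminf[OF bounded_bilinear.bounded_linear_left
          [OF bounded_bilinear_blinfun_compose] s])
  also have "\<dots> = (\<Sum>n. F o\<^sub>L (blinfun_power (t *\<^sub>R F) n /\<^sub>R fact n))"
  proof (rule suminf_cong)
    fix n
    have "(c *\<^sub>R blinfun_power F n) o\<^sub>L F = F o\<^sub>L (c *\<^sub>R blinfun_power F n)" for c
      using blinfun_power_commute[of n F]
      by (simp add: bounded_bilinear.scaleR_left[OF bounded_bilinear_blinfun_compose]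
          bounded_bilinear.scaleR_right[OF bounded_bilinear_blinfun_compose])
    then show "(blinfun_power (t *\<^sub>R F) n /\<^sub>R fact n) o\<^sub>L F
        = F o\<^sub>L (blinfun_power (t *\<^sub>R F) n /\<^sub>R fact n)"
      unfolding blinfun_power_scaleR scaleR_scaleR .
  qed
  also have "\<dots> = F o\<^sub>L blinfun_exp (t *\<^sub>R F)"
    unfolding blinfun_exp_def
    by (rule bounded_linear.suminf[OF bounded_bilinear.bounded_linear_right
          [OF bounded_bilinear_blinfun_compose] s, symmetric])
  finally show ?thesis .
qed

text \<open>Termwise differentiation of the exponential series. The constant term is split off first, so
  that the derivative of the \<open>n\<close>-th remaining term is \<open>F\<close> composed with the \<open>n\<close>-th term of the
  original series; the differentiated series converges uniformly on every bounded interval.\<close>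

lemma blinfun_exp_has_vector_derivative:
  fixes F :: "'a::banach \<Rightarrow>\<^sub>L 'a"
  shows "((\<lambda>t. blinfun_exp (t *\<^sub>R F)) has_vector_derivative (F o\<^sub>L blinfun_exp (t *\<^sub>R F)))
    (at t within S)"
proof -
  define r where "r = \<bar>t\<bar> + 1"
  define B where "B = {-r<..<r}"
  define e where "e n s = blinfun_power (s *\<^sub>R F) n /\<^sub>R fact n" for n s
  have e: "e n s = (s ^ n / fact n) *\<^sub>R blinfun_power F n" for n s
    by (simp add: e_def blinfun_power_scaleR divide_inverse mult.commute)
  have sum_e: "(\<lambda>n. e n s) sums blinfun_exp (s *\<^sub>R F)" for s
    unfolding e_def blinfun_exp_def by (rule summable_sums[OF summable_blinfun_exp])
  have deriv_term: "((\<lambda>s. e (Suc n) s) has_derivative (\<lambda>h. h *\<^sub>R (F o\<^sub>L e n s))) (at s within B)"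
    for n s
  proof -
    have "((\<lambda>s. s ^ Suc n / fact (Suc n)) has_real_derivative s ^ n / fact n) (at s within B)"
      by (rule derivative_eq_intros refl | simp)+
    from has_vector_derivative_scaleR[OF this has_vector_derivative_const]
    show ?thesis
      unfolding e has_vector_derivative_def
      by (simp add: bounded_bilinear.scaleR_right[OF bounded_bilinear_blinfun_compose])
  qed
  have unif: "uniform_limit B (\<lambda>n s. \<Sum>i<n. F o\<^sub>L e i s) (\<lambda>s. \<Sum>i. F o\<^sub>L e i s) sequentially"
  proof (rule Weierstrass_m_test)
    fix n s assume "s \<in> B"
    have "norm (F o\<^sub>L e n s) \<le> norm F * norm (e n s)"
      by (rule norm_blinfun_compose)
    also have "norm (e n s) \<le> norm (s *\<^sub>R F) ^ n /\<^sub>R fact n"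
      unfolding e_def by (rule norm_blinfun_exp_term_le)
    also have "\<dots> \<le> (r * norm F) ^ n /\<^sub>R fact n"
      using \<open>s \<in> B\<close> by (auto simp: B_def intro!: divide_right_mono power_mono mult_right_mono)
    finally show "norm (F o\<^sub>L e n s) \<le> norm F * ((r * norm F) ^ n /\<^sub>R fact n)"
      by (simp add: mult_left_mono)
  qed (intro summable_mult summable_exp_generic)
  have lim: "(\<Sum>i. F o\<^sub>L e i s) = F o\<^sub>L blinfun_exp (s *\<^sub>R F)" for s
    using bounded_linear.sums[OF bounded_bilinear.bounded_linear_right
        [OF bounded_bilinear_blinfun_compose] sum_e]
    by (rule sums_unique[symmetric])
  have tB: "t \<in> B" by (auto simp: B_def r_def)
  have unif_op: "\<forall>\<^sub>F n in sequentially. \<forall>s\<in>B. \<forall>h.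
      norm (sum (\<lambda>i. h *\<^sub>R (F o\<^sub>L e i s)) {..<n} - h *\<^sub>R (F o\<^sub>L blinfun_exp (s *\<^sub>R F))) \<le> c * norm h"
    if "c > 0" for c
    using uniform_limitD[OF unif that]
  proof eventually_elim
    case (elim n)
    show ?case
    proof (intro ballI allI)
      fix s h assume "s \<in> B"
      then have "norm ((\<Sum>i<n. F o\<^sub>L e i s) - (F o\<^sub>L blinfun_exp (s *\<^sub>R F))) \<le> c"
        using elim by (force simp: lim dist_norm)
      then have "\<bar>h\<bar> * norm ((\<Sum>i<n. F o\<^sub>L e i s) - (F o\<^sub>L blinfun_exp (s *\<^sub>R F))) \<le> \<bar>h\<bar> * c"
        by (intro mult_left_mono) auto
      then show "norm (sum (\<lambda>i. h *\<^sub>R (F o\<^sub>L e i s)) {..<n} - h *\<^sub>R (F o\<^sub>L blinfun_exp (s *\<^sub>R F)))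
          \<le> c * norm h"
        by (simp add: scaleR_sum_right[symmetric] scaleR_diff_right[symmetric] mult.commute)
    qed
  qed
  have tail: "(\<lambda>n. e (Suc n) s) sums (blinfun_exp (s *\<^sub>R F) - id_blinfun)" for s
    using sum_e[of s] sums_Suc_iff[of "\<lambda>n. e n s"] by (simp add: e)
  have "convex B" by (simp add: B_def)
  from has_derivative_series[OF this deriv_term unif_op tB tail]
  obtain g where g: "\<And>s. s \<in> B \<Longrightarrow> (\<lambda>n. e (Suc n) s) sums g s"
      and dg: "\<And>s. s \<in> B \<Longrightarrow> (g has_derivative (\<lambda>h. h *\<^sub>R (F o\<^sub>L blinfun_exp (s *\<^sub>R F)))) (at s within B)"
    by blast
  have g_eq: "g s = blinfun_exp (s *\<^sub>R F) - id_blinfun" if "s \<in> B" for s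
    using sums_unique2[OF g[OF that] tail] .
  have "(g has_vector_derivative (F o\<^sub>L blinfun_exp (t *\<^sub>R F))) (at t)"
    using dg[OF tB] tB
    by (simp add: has_vector_derivative_def B_def at_within_open[of t "{-r<..<r}"])
  then have "((\<lambda>s. g s + id_blinfun) has_vector_derivative (F o\<^sub>L blinfun_exp (t *\<^sub>R F))) (at t)"
    by (simp add: has_vector_derivative_add_const)
  then have "((\<lambda>s. blinfun_exp (s *\<^sub>R F)) has_vector_derivative (F o\<^sub>L blinfun_exp (t *\<^sub>R F))) (at t)"
    by (rule has_vector_derivative_transform_within_open[of _ _ _ B])
       (use tB in \<open>auto simp: B_def g_eq\<close>)
  then show ?thesis
    by (rule has_vector_derivative_at_within)
qed

section \<open>Linear evolution equations\<close>

lemma blinfun_exp_affine_has_vector_derivative: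
  fixes F :: "'a::banach \<Rightarrow>\<^sub>L 'a"
  shows "((\<lambda>s. blinfun_exp ((t - s) *\<^sub>R F)) has_vector_derivative
    - (blinfun_exp ((t - s) *\<^sub>R F) o\<^sub>L F)) (at s within S)"
proof -
  have "((\<lambda>s. t - s) has_vector_derivative -1) (at s within S)"
    by (auto intro!: derivative_eq_intros)
  from vector_diff_chain_within[OF this blinfun_exp_has_vector_derivative[of F]]
  show ?thesis
    by (simp add: o_def blinfun_exp_commute)
qed

lemma continuous_on_blinfun_exp:
  fixes F :: "'a::banach \<Rightarrow>\<^sub>L 'a"
  shows "continuous_on S (\<lambda>s. blinfun_exp ((t - s) *\<^sub>R F))"
  using has_vector_derivative_continuous[OF blinfun_exp_affine_has_vector_derivative]
  by (auto simp: continuous_on_eq_continuous_within)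

text \<open>The derivative of the exponential factor cancels the homogeneous part of \<open>y' = F y + g\<close>. Integrating
  from \<open>s\<close> to \<open>t\<close> recovers \<open>y t\<close>, since the factor is the identity at \<open>s = t\<close>.\<close>

lemma integrating_factor:
  fixes F :: "'a::banach \<Rightarrow>\<^sub>L 'a"
  assumes "(y has_vector_derivative F (y s) + g) (at s within S)"
  shows "((\<lambda>s. blinfun_exp ((t - s) *\<^sub>R F) (y s)) has_vector_derivative
    blinfun_exp ((t - s) *\<^sub>R F) g) (at s within S)"
  using bounded_bilinear.has_vector_derivative[OF bounded_bilinear_blinfun_apply
      blinfun_exp_affine_has_vector_derivative assms, of t F]
  by (simp add: blinfun.bilinear_simps)

lemma homogeneous_solution:
  fixes F :: "'a::banach \<Rightarrow>\<^sub>L 'a"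
  assumes y: "\<And>s. s \<in> {a..b} \<Longrightarrow> (y has_vector_derivative F (y s)) (at s within {a..b})"
    and "s \<in> {a..b}" "t \<in> {a..b}"
  shows "y t = blinfun_exp ((t - s) *\<^sub>R F) (y s)"
proof -
  have "((\<lambda>s. blinfun_exp ((t - s) *\<^sub>R F) (y s)) has_vector_derivative 0) (at s within {a..b})"
    if "s \<in> {a..b}" for s
    using integrating_factor[of y F s 0 "{a..b}" t] y[OF that] by (simp add: blinfun.bilinear_simps)
  from has_vector_derivative_zero_constant[OF convex_real_interval(5) this]
  obtain c where c: "\<And>s. s \<in> {a..b} \<Longrightarrow> blinfun_exp ((t - s) *\<^sub>R F) (y s) = c"
    by blast
  show ?thesis
    using c[OF assms(2)] c[OF assms(3)] by simp
qed

text \<open>The function \<open>s \<mapsto> exp (s F) x\<close> solves \<open>y' = F y\<close>, so its value at \<open>0\<close> is propagated from its value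
  at \<open>-t\<close> by \<open>exp (t F)\<close>.\<close>

lemma blinfun_exp_inverse:
  fixes F :: "'a::banach \<Rightarrow>\<^sub>L 'a"
  shows "blinfun_exp (t *\<^sub>R F) (blinfun_exp (- (t *\<^sub>R F)) x) = x"
proof -
  have "((\<lambda>s. blinfun_exp (s *\<^sub>R F) x) has_vector_derivative (F o\<^sub>L blinfun_exp (s *\<^sub>R F)) x)
      (at s within {-\<bar>t\<bar>..\<bar>t\<bar>})" for s
    by (rule bounded_linear.has_vector_derivative[OF blinfun.bounded_linear_left
          blinfun_exp_has_vector_derivative])
  then have "((\<lambda>s. blinfun_exp (s *\<^sub>R F) x) has_vector_derivative F (blinfun_exp (s *\<^sub>R F) x))
      (at s within {-\<bar>t\<bar>..\<bar>t\<bar>})" for s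
    by simp
  from homogeneous_solution[OF this, of "-t" 0] show ?thesis
    using abs_ge_self[of t] abs_ge_minus_self[of t] by simp
qed

lemma variation_of_constants:
  fixes F :: "'a::banach \<Rightarrow>\<^sub>L 'a" and y0 :: 'a
  assumes g: "continuous_on {0..T} g" and t: "t \<in> {0..T}"
  defines "y \<equiv> \<lambda>t. blinfun_exp (t *\<^sub>R F) (y0 + integral {0..t} (\<lambda>s. blinfun_exp ((- s) *\<^sub>R F) (g s)))"
  shows "(y has_vector_derivative F (y t) + g t) (at t within {0..T})"
proof -
  have "continuous_on {0..T} (\<lambda>s. blinfun_exp ((- s) *\<^sub>R F) (g s))"
    using continuous_on_blinfun_exp[of "{0..T}" 0 F] g
    by (intro blinfun.continuous_on) auto
  from integral_has_vector_derivative[OF this t]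
  have "((\<lambda>t. y0 + integral {0..t} (\<lambda>s. blinfun_exp ((- s) *\<^sub>R F) (g s)))
      has_vector_derivative blinfun_exp ((- t) *\<^sub>R F) (g t)) (at t within {0..T})"
    by (simp add: add.commute[of y0] has_vector_derivative_add_const)
  from bounded_bilinear.has_vector_derivative[OF bounded_bilinear_blinfun_apply
      blinfun_exp_has_vector_derivative this, of F]
  show ?thesis
    unfolding y_def by (simp add: blinfun_exp_inverse add.commute)
qed

section \<open>Riesz representation and adjoints\<close>

text \<open>The representing vector minimizes the functional \<open>\<parallel>x\<parallel>\<^sup>2 - 2 f(x)\<close>. By the parallelogram law a
  minimizing sequence is Cauchy, and stationarity at the minimizer is the asserted identity.\<close>

lemma riesz_representation:
  fixes f :: "'a::{real_inner,banach} \<Rightarrow> real"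
  assumes f: "bounded_linear f"
  shows "\<exists>z. \<forall>x. f x = inner x z"
proof -
  interpret f: bounded_linear f by fact
  define J where "J x = (norm x)\<^sup>2 - 2 * f x" for x
  define m where "m = Inf (range J)"
  obtain K where K: "\<And>x. norm (f x) \<le> norm x * K" using f.bounded by blast
  have "- K\<^sup>2 \<le> J x" for x
  proof -
    have "f x \<le> norm x * K" using K[of x] by simp
    moreover have "0 \<le> (norm x - K)\<^sup>2" by simp
    ultimately show ?thesis by (simp add: J_def power2_diff)
  qed
  then have bdd: "bdd_below (range J)" by (rule bdd_belowI2)
  have m_le: "m \<le> J x" for x
    unfolding m_def using bdd by (rule cInf_lower[rotated]) simp
  have "\<exists>x. J x < m + inverse (real (Suc n))" for n
  proof -
    have "Inf (range J) < m + inverse (real (Suc n))" by (simp add: m_def)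
    from cInf_lessD[OF _ this] show ?thesis by auto
  qed
  then obtain X where X: "\<And>n. J (X n) < m + inverse (real (Suc n))" by metis
  have par: "(norm (x - y))\<^sup>2 \<le> 2 * (J x - m) + 2 * (J y - m)" for x y
  proof -
    have "4 * J ((1/2) *\<^sub>R (x + y)) = (norm (x + y))\<^sup>2 - 4 * (f x + f y)"
      by (simp add: J_def power_mult_distrib f.scaleR f.add power_divide add_divide_distrib)
    moreover have "(norm (x + y))\<^sup>2 + (norm (x - y))\<^sup>2 = 2 * (norm x)\<^sup>2 + 2 * (norm y)\<^sup>2"
      by (simp add: power2_norm_eq_inner inner_simps inner_commute)
    ultimately show ?thesis using m_le[of "(1/2) *\<^sub>R (x + y)"] by (simp add: J_def)
  qed
  have inv0: "(\<lambda>n. inverse (real (Suc n))) \<longlonglongrightarrow> 0"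
    by (rule LIMSEQ_inverse_real_of_nat)
  have "Cauchy X"
  proof (rule metric_CauchyI)
    fix e :: real assume "0 < e"
    then obtain N where N: "\<And>n. n \<ge> N \<Longrightarrow> inverse (real (Suc n)) < e\<^sup>2 / 4"
      using order_tendstoD(2)[OF inv0, of "e\<^sup>2 / 4"] by (auto simp: eventually_sequentially)
    have near: "J (X n) < m + e\<^sup>2 / 4" if "n \<ge> N" for n
      by (rule less_trans[OF X add_strict_left_mono[OF N[OF that]]])
    have "dist (X k) (X n) < e" if "k \<ge> N" "n \<ge> N" for k n
    proof -
      have "(norm (X k - X n))\<^sup>2 < e\<^sup>2"
        using par[of "X k" "X n"] near[OF that(1)] near[OF that(2)] by argo
      then show ?thesis using \<open>0 < e\<close> by (simp add: dist_norm power2_less_imp_less)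
    qed
    then show "\<exists>N. \<forall>k\<ge>N. \<forall>n\<ge>N. dist (X k) (X n) < e" by blast
  qed
  then obtain z where z: "X \<longlonglongrightarrow> z" using Cauchy_convergent convergent_def by blast
  have "(\<lambda>n. J (X n)) \<longlonglongrightarrow> J z"
    unfolding J_def by (intro tendsto_intros z f.tendsto)
  moreover have "(\<lambda>n. m + inverse (real (Suc n))) \<longlonglongrightarrow> m + 0"
    by (intro tendsto_intros inv0)
  ultimately have "J z \<le> m + 0"
    by (rule LIMSEQ_le) (use X less_imp_le in blast)
  then have min: "J z \<le> J x" for x using m_le[of x] by simp
  have "f x = inner x z" for x
  proof (cases "x = 0")
    case False
    define d where "d = f x - inner x z"
    define t where "t = d / (norm x)\<^sup>2"
    have "J (z + t *\<^sub>R x) = J z - 2 * t * d + t\<^sup>2 * (norm x)\<^sup>2"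
      unfolding J_def d_def power2_norm_eq_inner
      by (simp add: f.add f.scaleR inner_simps inner_commute power2_eq_square algebra_simps)
    with min[of "z + t *\<^sub>R x"] have "2 * t * d \<le> t\<^sup>2 * (norm x)\<^sup>2" by simp
    moreover have "t\<^sup>2 * (norm x)\<^sup>2 = t * d" "t * d = d\<^sup>2 / (norm x)\<^sup>2"
      using False by (simp_all add: t_def power2_eq_square)
    ultimately have "d\<^sup>2 / (norm x)\<^sup>2 \<le> 0" by simp
    then show ?thesis using False by (simp add: d_def divide_le_0_iff)
  qed (simp add: f.zero)
  then show ?thesis by blast
qed

text \<open>The library defines \<open>adjoint\<close> by choice; Riesz representation shows that an adjoint exists,
  so that the chosen function is one.\<close>

lemma norm_blinfun_adjoint_le:
  fixes F :: "'a::{real_inner,banach} \<Rightarrow>\<^sub>L 'b::{real_inner,banach}"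
  shows "norm (blinfun_adjoint F) \<le> norm F"
proof -
  define G where "G = adjoint (blinfun_apply F)"
  have "\<exists>z. \<forall>x. inner (F x) y = inner x z" for y
    by (rule riesz_representation) (intro bounded_linear_intros)
  then have "\<exists>G. \<forall>x y. inner (F x) y = inner x (G y)" by metis
  then have G: "inner (F x) y = inner x (G y)" for x y
    unfolding G_def adjoint_def by (rule someI2_ex) blast
  have lin: "linear G"
  proof (rule linearI)
    show "G (x + y) = G x + G y" for x y
      by (rule vector_eq_rdot[THEN iffD1]) (simp add: G[symmetric] inner_simps inner_commute)
    show "G (r *\<^sub>R x) = r *\<^sub>R G x" for r x
      by (rule vector_eq_rdot[THEN iffD1]) (simp add: G[symmetric] inner_simps inner_commute)
  qed
  have bound: "norm (G y) \<le> norm F * norm y" for y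
  proof (cases "G y = 0")
    case False
    have "norm (G y) * norm (G y) = inner (F (G y)) y"
      by (simp add: G power2_norm_eq_inner[symmetric] power2_eq_square)
    also have "\<dots> \<le> norm (F (G y)) * norm y" by (rule norm_cauchy_schwarz)
    also have "\<dots> \<le> (norm F * norm (G y)) * norm y"
      by (intro mult_right_mono norm_blinfun) simp
    finally have "norm (G y) * norm (G y) \<le> (norm F * norm y) * norm (G y)"
      by (simp add: mult_ac)
    then show ?thesis using False by (simp add: mult_le_cancel_right)
  qed simp
  have "bounded_linear G"
    using lin bound by (intro bounded_linear_intro[where K = "norm F"])
      (auto simp: linear_add linear_scale mult.commute)
  then show ?thesis
    unfolding blinfun_adjoint_def G_def[symmetric]
    by (intro norm_blinfun_bound) (auto simp: bounded_linear_Blinfun_apply bound)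
qed

section \<open>Coercive operators\<close>

lemma coercive_norm_lower_bound:
  assumes "(norm p)\<^sup>2 \<le> inner q p"
  shows "norm p \<le> norm q"
proof (cases "p = 0")
  case False
  have "norm p * norm p \<le> norm q * norm p"
    using assms norm_cauchy_schwarz[of q p] by (simp add: power2_eq_square)
  then show ?thesis using False by simp
qed simp

text \<open>The Lax--Milgram theorem by Banach's fixed point theorem: for small \<open>c\<close> the map
  \<open>p \<mapsto> p - c (S p - b)\<close> is a contraction, and its fixed point solves \<open>S p = b\<close>.\<close>

lemma coercive_surjective:
  fixes S :: "'a::{real_inner,banach} \<Rightarrow>\<^sub>L 'a"
  assumes coercive: "\<And>p. (norm p)\<^sup>2 \<le> inner (S p) p"
  shows "\<exists>p. S p = b"
proof -
  define L where "L = (norm S)\<^sup>2 + 1"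
  define c where "c = 1 / L"
  have L: "L \<ge> 1" by (simp add: L_def)
  then have c: "0 < c" "c \<le> 1" by (auto simp: c_def)
  have contr: "(norm (p - c *\<^sub>R S p))\<^sup>2 \<le> (1 - c) * (norm p)\<^sup>2" for p
  proof -
    have "(norm (S p))\<^sup>2 \<le> (norm S * norm p)\<^sup>2"
      by (intro power_mono norm_blinfun) simp
    also have "\<dots> \<le> L * (norm p)\<^sup>2"
      by (simp add: L_def power_mult_distrib mult_right_mono)
    finally have "c\<^sup>2 * (norm (S p))\<^sup>2 \<le> c\<^sup>2 * (L * (norm p)\<^sup>2)" by (intro mult_left_mono) auto
    also have "c\<^sup>2 * (L * (norm p)\<^sup>2) = c * (norm p)\<^sup>2"
      using L by (simp add: c_def power2_eq_square)
    finally have quad: "c\<^sup>2 * (norm (S p))\<^sup>2 \<le> c * (norm p)\<^sup>2" .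
    have lin: "c * (norm p)\<^sup>2 \<le> c * inner (S p) p" using coercive c by simp
    have "(norm (p - c *\<^sub>R S p))\<^sup>2 = (norm p)\<^sup>2 - 2 * (c * inner (S p) p) + c\<^sup>2 * (norm (S p))\<^sup>2"
      unfolding power2_norm_eq_inner
      by (simp add: inner_simps inner_commute power2_eq_square algebra_simps)
    then show ?thesis using quad lin by (simp add: algebra_simps)
  qed
  have "\<exists>!p. p - c *\<^sub>R (S p - b) = p"
  proof (rule banach_fix_type[of "sqrt (1 - c)"])
    have "norm (p - c *\<^sub>R S p) \<le> sqrt (1 - c) * norm p" for p
      using real_sqrt_le_mono[OF contr[of p]] by (simp add: real_sqrt_mult)
    from this[of "p - q" for p q]
    show "\<forall>p q. dist (p - c *\<^sub>R (S p - b)) (q - c *\<^sub>R (S q - b)) \<le> sqrt (1 - c) * dist p q"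
      by (simp add: dist_norm blinfun.bilinear_simps algebra_simps)
  qed (use c in auto)
  then show ?thesis using c by auto
qed

section \<open>The optimality system\<close>

text \<open>With the feedback law of the optimality system, an adjoint state with final value \<open>p\<close> produces the
  forcing term \<open>B u(s) = - closed_loop_input D \<mu> s p\<close> in the state equation.\<close>

definition closed_loop_input ::
    "('p, 'x::{real_inner,banach}, 'u::{real_inner,banach}) lq_problem \<Rightarrow> 'p \<Rightarrow> real \<Rightarrow> 'x \<Rightarrow>\<^sub>L 'x" where
  "closed_loop_input D \<mu> s = control_op D \<mu>
      o\<^sub>L blinfun_inv (control_weight D)
      o\<^sub>L blinfun_adjoint (control_op D \<mu>)
      o\<^sub>L blinfun_exp ((horizon D - s) *\<^sub>R blinfun_adjoint (state_op D \<mu>))"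

lemma gramian_eq:
  "gramian D \<mu> = integral {0..horizon D} (\<lambda>s.
      blinfun_exp ((horizon D - s) *\<^sub>R state_op D \<mu>) o\<^sub>L closed_loop_input D \<mu> s)"
  by (simp add: gramian_def closed_loop_input_def blinfun_compose_assoc)

lemma continuous_on_closed_loop_input: "continuous_on S (closed_loop_input D \<mu>)"
  unfolding closed_loop_input_def
  by (intro bounded_bilinear.continuous_on[OF bounded_bilinear_blinfun_compose]
      continuous_on_const continuous_on_blinfun_exp)

lemma continuous_on_gramian_integrand:
  "continuous_on S (\<lambda>s. blinfun_exp ((horizon D - s) *\<^sub>R state_op D \<mu>) o\<^sub>L closed_loop_input D \<mu> s)"
  by (intro bounded_bilinear.continuous_on[OF bounded_bilinear_blinfun_compose]
      continuous_on_blinfun_exp continuous_on_closed_loop_input)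

lemma gramian_apply_has_integral:
  "((\<lambda>s. blinfun_exp ((horizon D - s) *\<^sub>R state_op D \<mu>) (closed_loop_input D \<mu> s p))
    has_integral gramian D \<mu> p) {0..horizon D}"
proof -
  have "((\<lambda>s. blinfun_exp ((horizon D - s) *\<^sub>R state_op D \<mu>) o\<^sub>L closed_loop_input D \<mu> s)
      has_integral gramian D \<mu>) {0..horizon D}"
    unfolding gramian_eq
    by (intro integrable_integral integrable_continuous_interval continuous_on_gramian_integrand)
  from has_integral_linear[OF this blinfun.bounded_linear_left, of p]
  show ?thesis by (simp add: o_def)
qed

text \<open>Up to sign, the Gramian collects the effect that the forcing generated by \<open>p\<close> has at the final
  time.\<close>

lemma closed_loop_final_state:
  assumes T: "horizon D > 0"
    and x: "\<And>t. t \<in> {0..horizon D} \<Longrightarrow>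
      (x has_vector_derivative (state_op D \<mu> (x t) + - closed_loop_input D \<mu> t p))
        (at t within {0..horizon D})"
  shows "x (horizon D) = blinfun_exp (horizon D *\<^sub>R state_op D \<mu>) (x 0) - gramian D \<mu> p"
proof -
  let ?E = "\<lambda>s. blinfun_exp ((horizon D - s) *\<^sub>R state_op D \<mu>)"
  have "((\<lambda>s. ?E s (x s)) has_vector_derivative - ?E s (closed_loop_input D \<mu> s p))
      (at s within {0..horizon D})" if "s \<in> {0..horizon D}" for s
    using integrating_factor[OF x[OF that], of "horizon D"] by (simp add: blinfun.bilinear_simps)
  from fundamental_theorem_of_calculus[OF less_imp_le[OF T] this]
  have "((\<lambda>s. - ?E s (closed_loop_input D \<mu> s p)) has_integral
      x (horizon D) - blinfun_exp (horizon D *\<^sub>R state_op D \<mu>) (x 0)) {0..horizon D}"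
    by simp
  from has_integral_unique[OF this has_integral_neg[OF gramian_apply_has_integral]]
  show ?thesis by (simp add: algebra_simps)
qed

text \<open>In any solution the adjoint state is determined by \<open>\<phi>(T)\<close>, so the forcing is a linear image of
  \<open>\<phi>(T)\<close> and the final state is \<open>exp(T A) x\<^sup>0 - \<Lambda> \<phi>(T)\<close>. Inserting this into the terminal condition
  gives the linear system.\<close>

lemma optimality_system_imp_system_op:
  assumes T: "horizon D > 0" and opt: "optimality_system D \<mu> x \<phi> u"
  shows "system_op D \<mu> (\<phi> (horizon D)) = system_rhs D \<mu>"
proof -
  let ?T = "horizon D" and ?A = "state_op D \<mu>"
  define p where "p = \<phi> ?T"
  have dx: "(x has_vector_derivative (?A (x t) + control_op D \<mu> (u t))) (at t within {0..?T})"
    and d\<phi>: "(\<phi> has_vector_derivative (- blinfun_adjoint ?A) (\<phi> t)) (at t within {0..?T})"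
    and u: "u t = - blinfun_inv (control_weight D) (blinfun_adjoint (control_op D \<mu>) (\<phi> t))"
    if "t \<in> {0..?T}" for t
    using opt that unfolding optimality_system_def uminus_blinfun.rep_eq by blast+
  have x0: "x 0 = init_state D \<mu>" and xT: "p = final_weight D (x ?T - target_state D \<mu>)"
    using opt by (simp_all add: optimality_system_def p_def)
  have "\<phi> t = blinfun_exp ((?T - t) *\<^sub>R blinfun_adjoint ?A) p" if "t \<in> {0..?T}" for t
  proof -
    have "\<phi> t = blinfun_exp ((t - ?T) *\<^sub>R - blinfun_adjoint ?A) (\<phi> ?T)"
      by (rule homogeneous_solution[OF d\<phi>]) (use that T in auto)
    moreover have "(t - ?T) *\<^sub>R - blinfun_adjoint ?A = (?T - t) *\<^sub>R blinfun_adjoint ?A"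
      by (simp add: algebra_simps)
    ultimately show ?thesis by (simp add: p_def)
  qed
  then have Bu: "control_op D \<mu> (u t) = - closed_loop_input D \<mu> t p" if "t \<in> {0..?T}" for t
    using that by (simp add: u closed_loop_input_def blinfun.bilinear_simps)
  have "x ?T = blinfun_exp (?T *\<^sub>R ?A) (x 0) - gramian D \<mu> p"
    by (rule closed_loop_final_state[OF T]) (use dx Bu in force)
  then have "p = final_weight D
      (blinfun_exp (?T *\<^sub>R ?A) (init_state D \<mu>) - gramian D \<mu> p - target_state D \<mu>)"
    using xT x0 by simp
  then show ?thesis
    unfolding p_def[symmetric] system_op_def system_rhs_def
    by (simp add: blinfun.bilinear_simps algebra_simps)
qed

text \<open>Conversely, the adjoint state started backwards from \<open>p\<close> determines control and state, and the
  linear system is exactly the terminal condition that remains to be checked.\<close>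

lemma optimality_system_exists:
  assumes T: "horizon D > 0" and p: "system_op D \<mu> p = system_rhs D \<mu>"
  shows "\<exists>x \<phi> u. optimality_system D \<mu> x \<phi> u \<and> \<phi> (horizon D) = p"
proof -
  let ?T = "horizon D" and ?A = "state_op D \<mu>"
  define \<phi> where "\<phi> t = blinfun_exp ((?T - t) *\<^sub>R blinfun_adjoint ?A) p" for t
  define u where "u t = - blinfun_inv (control_weight D) (blinfun_adjoint (control_op D \<mu>) (\<phi> t))" for t
  define x where "x t = blinfun_exp (t *\<^sub>R ?A) (init_state D \<mu>
      + integral {0..t} (\<lambda>s. blinfun_exp ((- s) *\<^sub>R ?A) (control_op D \<mu> (u s))))" for t
  have Bu: "control_op D \<mu> (u t) = - closed_loop_input D \<mu> t p" for t
    by (simp add: u_def \<phi>_def closed_loop_input_def blinfun.bilinear_simps)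
  have "continuous_on {0..?T} (\<lambda>t. control_op D \<mu> (u t))"
    unfolding Bu
    by (intro continuous_on_minus blinfun.continuous_on continuous_on_closed_loop_input continuous_on_const)
  from variation_of_constants[OF this, of _ ?A "init_state D \<mu>"]
  have dx: "(x has_vector_derivative (?A (x t) + control_op D \<mu> (u t))) (at t within {0..?T})"
    if "t \<in> {0..?T}" for t
    using that unfolding x_def by blast
  have "(\<phi> has_vector_derivative
      (- (blinfun_exp ((?T - t) *\<^sub>R blinfun_adjoint ?A) o\<^sub>L blinfun_adjoint ?A)) p)
      (at t within {0..?T})" for t
    unfolding \<phi>_def
    by (rule bounded_linear.has_vector_derivative[OF blinfun.bounded_linear_left
          blinfun_exp_affine_has_vector_derivative])
  then have d\<phi>: "(\<phi> has_vector_derivative - blinfun_adjoint ?A (\<phi> t)) (at t within {0..?T})" for t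
    unfolding blinfun_exp_commute by (simp add: \<phi>_def uminus_blinfun.rep_eq)
  have x0: "x 0 = init_state D \<mu>" by (simp add: x_def)
  have \<phi>T: "\<phi> ?T = p" by (simp add: \<phi>_def)
  have xT: "x ?T = blinfun_exp (?T *\<^sub>R ?A) (init_state D \<mu>) - gramian D \<mu> p"
    unfolding x0[symmetric] by (rule closed_loop_final_state[OF T]) (use dx Bu in force)
  have "p = final_weight D (x ?T - target_state D \<mu>)"
    using p unfolding xT system_op_def system_rhs_def
    by (simp add: blinfun.bilinear_simps algebra_simps)
  then have "optimality_system D \<mu> x \<phi> u"
    unfolding optimality_system_def using dx d\<phi> x0 \<phi>T u_def by auto
  then show ?thesis using \<phi>T by blast
qed

lemma system_op_coercive:
  assumes "positive_semidefinite (final_weight D o\<^sub>L gramian D \<mu>)"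
  shows "(norm p)\<^sup>2 \<le> inner (system_op D \<mu> p) p"
  using assms
  by (simp add: positive_semidefinite_def system_op_def blinfun.bilinear_simps inner_simps
      power2_norm_eq_inner)

lemma system_op_norm_lower_bound:
  assumes "positive_semidefinite (final_weight D o\<^sub>L gramian D \<mu>)"
  shows "norm p \<le> norm (system_op D \<mu> p)"
  by (rule coercive_norm_lower_bound[OF system_op_coercive[OF assms]])

text \<open>Coercivity makes the linear system uniquely solvable, so the optimality system determines
  \<open>\<phi>(T)\<close> and the definite description in \<open>final_adjoint\<close> denotes the solution.\<close>

lemma system_op_final_adjoint:
  assumes T: "horizon D > 0" and psd: "positive_semidefinite (final_weight D o\<^sub>L gramian D \<mu>)"
  shows "system_op D \<mu> (final_adjoint D \<mu>) = system_rhs D \<mu>"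
proof -
  obtain p where p: "system_op D \<mu> p = system_rhs D \<mu>"
    using coercive_surjective[OF system_op_coercive[OF psd]] by blast
  have uniq: "q = p" if "system_op D \<mu> q = system_rhs D \<mu>" for q
    using system_op_norm_lower_bound[OF psd, of "q - p"] that p by (simp add: blinfun.bilinear_simps)
  have "final_adjoint D \<mu> = p"
    unfolding final_adjoint_def
    using optimality_system_exists[OF T p] optimality_system_imp_system_op[OF T] uniq
    by (intro the_equality) blast+
  then show ?thesis using p by simp
qed

text \<open>The residual dominates the error because \<open>I + M \<Lambda>\<close> is bounded below by the identity, and is
  dominated by it because \<open>I + M \<Lambda>\<close> is bounded.\<close>

lemma error_estimator_bounds:
  assumes "horizon D > 0" "positive_semidefinite (final_weight D o\<^sub>L gramian D \<mu>)"
  shows norm_error_le_error_estimator: "norm (final_adjoint D \<mu> - p) \<le> error_estimator D \<mu> p"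
    and error_estimator_le_norm_error:
      "error_estimator D \<mu> p \<le> norm (system_op D \<mu>) * norm (final_adjoint D \<mu> - p)"
proof -
  have "error_estimator D \<mu> p = norm (system_op D \<mu> (final_adjoint D \<mu> - p))"
    unfolding error_estimator_def system_op_final_adjoint[OF assms, symmetric]
    by (simp add: blinfun.bilinear_simps)
  then show "norm (final_adjoint D \<mu> - p) \<le> error_estimator D \<mu> p"
    and "error_estimator D \<mu> p \<le> norm (system_op D \<mu>) * norm (final_adjoint D \<mu> - p)"
    using system_op_norm_lower_bound[OF assms(2)] norm_blinfun by metis+
qed

section \<open>Uniform boundedness of the system operators\<close>

lemma norm_blinfun_compose_le:
  assumes "norm F \<le> a" "norm G \<le> b"
  shows "norm (F o\<^sub>L G) \<le> a * b"
  using norm_blinfun_compose[of F G] mult_mono'[OF assms] by simp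

lemma norm_blinfun_exp_scaleR_le:
  fixes F :: "'a::banach \<Rightarrow>\<^sub>L 'a"
  assumes "norm F \<le> a" "0 \<le> t" "t \<le> T"
  shows "norm (blinfun_exp (t *\<^sub>R F)) \<le> exp (T * a)"
proof -
  have "norm (t *\<^sub>R F) \<le> T * a"
    using assms by (auto intro!: mult_mono)
  then show ?thesis
    using norm_blinfun_exp_le[of "t *\<^sub>R F"] exp_le_cancel_iff order_trans by blast
qed

lemma norm_gramian_le:
  assumes T: "horizon D > 0" and a: "norm (state_op D \<mu>) \<le> a" and b: "norm (control_op D \<mu>) \<le> b"
  shows "norm (gramian D \<mu>) \<le> exp (horizon D * a)
      * (b * norm (blinfun_inv (control_weight D)) * b * exp (horizon D * a)) * horizon D"
proof -
  have a': "norm (blinfun_adjoint (state_op D \<mu>)) \<le> a"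
    and b': "norm (blinfun_adjoint (control_op D \<mu>)) \<le> b"
    using norm_blinfun_adjoint_le order_trans a b by blast+
  have "norm (blinfun_exp ((horizon D - s) *\<^sub>R state_op D \<mu>) o\<^sub>L closed_loop_input D \<mu> s)
      \<le> exp (horizon D * a) * (b * norm (blinfun_inv (control_weight D)) * b * exp (horizon D * a))"
    if "s \<in> {0..horizon D}" for s
    unfolding closed_loop_input_def using that
    by (intro norm_blinfun_compose_le norm_blinfun_exp_scaleR_le a b a' b' order_refl) auto
  from integral_bound[OF less_imp_le[OF T] continuous_on_gramian_integrand this]
  show ?thesis unfolding gramian_eq by simp
qed

lemma lipschitz_on_compact_bounded:
  assumes "compact S" "\<exists>L. L-lipschitz_on S f"
  obtains b where "\<And>x. x \<in> S \<Longrightarrow> norm (f x) \<le> b"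
proof -
  have "bounded (f ` S)"
    using assms compact_continuous_image lipschitz_on_continuous_on compact_imp_bounded by blast
  then show ?thesis using that by (auto simp: bounded_iff)
qed

text \<open>A real supremum is an upper bound only if the set is bounded above. Here a bound comes from
  compactness of the parameter set through the norms of the state and control operators.\<close>

lemma norm_system_op_le_system_bound:
  assumes "horizon D > 0" "compact P"
    and "\<exists>L. L-lipschitz_on P (state_op D)" "\<exists>L. L-lipschitz_on P (control_op D)"
    and "\<mu> \<in> P"
  shows "norm (system_op D \<mu>) \<le> system_bound P D"
proof -
  obtain a where a: "\<And>\<mu>. \<mu> \<in> P \<Longrightarrow> norm (state_op D \<mu>) \<le> a"
    using lipschitz_on_compact_bounded[OF assms(2,3)] by blast
  obtain b where b: "\<And>\<mu>. \<mu> \<in> P \<Longrightarrow> norm (control_op D \<mu>) \<le> b"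
    using lipschitz_on_compact_bounded[OF assms(2,4)] by blast
  define g where "g = exp (horizon D * a)
      * (b * norm (blinfun_inv (control_weight D)) * b * exp (horizon D * a)) * horizon D"
  have "norm (system_op D \<nu>) \<le> 1 + norm (final_weight D) * g" if "\<nu> \<in> P" for \<nu>
  proof -
    have "norm (gramian D \<nu>) \<le> g"
      unfolding g_def using assms(1) a[OF that] b[OF that] by (rule norm_gramian_le)
    then show ?thesis
      unfolding system_op_def
      by (rule norm_triangle_mono[OF norm_blinfun_id_le norm_blinfun_compose_le[OF order_refl]])
  qed
  then have "bdd_above ((\<lambda>\<mu>. norm (system_op D \<mu>)) ` P)" by (rule bdd_aboveI2)
  then show ?thesis
    unfolding system_bound_def using assms(5) by (rule cSUP_upper2) simp
qed

section \<open>Orthogonal projection onto finitely generated subspaces\<close>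

text \<open>The Gram--Schmidt process, one generator at a time: the new generator \<open>b\<close> is made orthogonal to the
  old span by subtracting its projection \<open>c\<close>, and the component of \<open>y\<close> along \<open>b - c\<close> is added.\<close>

lemma orth_proj_exists:
  fixes y :: "'a::real_inner"
  assumes "finite B"
  shows "\<exists>w\<in>span B. \<forall>v\<in>span B. orthogonal (y - w) v"
  using assms
proof (induction B arbitrary: y rule: finite_induct)
  case empty
  show ?case by (simp add: orthogonal_def)
next
  case (insert b B)
  obtain c where c: "c \<in> span B" "\<And>v. v \<in> span B \<Longrightarrow> orthogonal (b - c) v"
    using insert.IH by metis
  obtain w where w: "w \<in> span B" "\<And>v. v \<in> span B \<Longrightarrow> orthogonal (y - w) v"
    using insert.IH by metis
  \<comment> \<open>If \<open>b = c\<close>, the denominator vanishes; any value of \<open>t\<close> would then do.\<close>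
  define t where "t = inner y (b - c) / inner (b - c) (b - c)"
  have span_c: "c \<in> span (insert b B)" and span_w: "w \<in> span (insert b B)"
    using c(1) w(1) span_mono[of B "insert b B"] by auto
  have "w + t *\<^sub>R (b - c) \<in> span (insert b B)"
    by (intro span_add span_scale span_diff span_c span_w) (simp add: span_base)
  moreover have "orthogonal (y - (w + t *\<^sub>R (b - c))) v" if v: "v \<in> span (insert b B)" for v
  proof -
    obtain k where "v - k *\<^sub>R b \<in> span B" using v by (auto simp: span_insert)
    then have k: "v - k *\<^sub>R (b - c) \<in> span B"
      using span_add[OF _ span_scale[OF c(1), of k]] by (fastforce simp: algebra_simps)
    have "inner (y - (w + t *\<^sub>R (b - c))) (v - k *\<^sub>R (b - c)) = 0"
      using w(2)[OF k] c(2)[OF k] unfolding orthogonal_def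
      by (simp add: inner_diff_left inner_add_left)
    moreover have "inner (y - (w + t *\<^sub>R (b - c))) (b - c) = 0"
    proof -
      have "inner w (b - c) = 0" using c(2)[OF w(1)] by (simp add: orthogonal_def inner_commute)
      moreover have "t * inner (b - c) (b - c) = inner y (b - c)"
        by (cases "b = c") (simp_all add: t_def)
      ultimately show ?thesis
        by (simp only: inner_diff_left[of y] inner_add_left[of w] inner_scaleR_left)
    qed
    ultimately have "inner (y - (w + t *\<^sub>R (b - c))) (v - k *\<^sub>R (b - c) + k *\<^sub>R (b - c)) = 0"
      by (simp only: inner_add_right inner_scaleR_right)
    then show ?thesis by (simp add: orthogonal_def)
  qed
  ultimately show ?case by blast
qed

lemma orth_proj:
  fixes y :: "'a::real_inner"
  assumes "finite B"
  shows orth_proj_in_span: "orth_proj (span B) y \<in> span B"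
    and orthogonal_orth_proj: "\<And>v. v \<in> span B \<Longrightarrow> orthogonal (y - orth_proj (span B) y) v"
proof -
  obtain w where w: "w \<in> span B" "\<forall>v\<in>span B. orthogonal (y - w) v"
    using orth_proj_exists[OF assms] by blast
  have "w' = w" if w': "w' \<in> span B" "\<forall>v\<in>span B. orthogonal (y - w') v" for w'
  proof -
    have "w' - w \<in> span B" using w(1) w'(1) by (rule span_diff[rotated])
    then have "inner (y - w) (w' - w) = 0" "inner (y - w') (w' - w) = 0"
      using w(2) w'(2) by (auto simp: orthogonal_def)
    then have "inner (w' - w) (w' - w) = 0" by (simp add: inner_diff_left)
    then show ?thesis by simp
  qed
  then have "orth_proj (span B) y = w"
    unfolding orth_proj_def using w by (intro the_equality) blast+
  then show "orth_proj (span B) y \<in> span B"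
    and "\<And>v. v \<in> span B \<Longrightarrow> orthogonal (y - orth_proj (span B) y) v"
    using w by simp_all
qed

lemma orth_proj_best_approximation:
  fixes y :: "'a::real_inner"
  assumes "finite B" "v \<in> span B"
  shows "norm (y - orth_proj (span B) y) \<le> norm (y - v)"
proof -
  let ?w = "orth_proj (span B) y"
  have "orthogonal (y - ?w) (?w - v)"
    using orth_proj[OF assms(1)] assms(2) by (intro orthogonal_orth_proj span_diff assms(1)) auto
  from norm_add_Pythagorean[OF this]
  have "(norm (y - ?w))\<^sup>2 \<le> (norm (y - v))\<^sup>2" by simp
  then show ?thesis by (rule power2_le_imp_le) simp
qed

section \<open>Linear combinations\<close>

text \<open>Linear independence of the family \<open>\<phi> 1, \<dots>, \<phi> k\<close>; unlike independence of the set
  of its members, this excludes repetitions.\<close>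

definition lin_indep_family :: "nat \<Rightarrow> (nat \<Rightarrow> 'a::real_vector) \<Rightarrow> bool" where
  "lin_indep_family k \<phi> \<longleftrightarrow> (\<forall>a. lin_comb k \<phi> a = 0 \<longrightarrow> (\<forall>i\<in>{1..k}. a i = 0))"

lemma lin_comb_diff: "lin_comb k \<phi> (\<lambda>i. a i - b i) = lin_comb k \<phi> a - lin_comb k \<phi> b"
  by (simp add: lin_comb_def scaleR_diff_left sum_subtractf)

lemma lin_comb_scale: "lin_comb k \<phi> (\<lambda>i. c * a i) = c *\<^sub>R lin_comb k \<phi> a"
  by (simp add: lin_comb_def scaleR_sum_right)

lemma blinfun_apply_lin_comb: "blinfun_apply F (lin_comb k \<phi> a) = lin_comb k (\<lambda>i. F (\<phi> i)) a"
  by (simp add: lin_comb_def blinfun.sum_right blinfun.scaleR_right)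

lemma span_family_eq: "span (\<phi> ` {1..k}) = range (lin_comb k \<phi>)"
proof
  show "range (lin_comb k \<phi>) \<subseteq> span (\<phi> ` {1..k})"
    unfolding lin_comb_def by (intro image_subsetI span_sum span_scale span_base imageI)
  show "span (\<phi> ` {1..k}) \<subseteq> range (lin_comb k \<phi>)"
  proof (rule span_minimal)
    show "\<phi> ` {1..k} \<subseteq> range (lin_comb k \<phi>)"
    proof safe
      fix i assume "i \<in> {1..k}"
      then have "lin_comb k \<phi> (\<lambda>j. if j = i then 1 else 0) = \<phi> i"
        by (simp add: lin_comb_def if_distrib[of "\<lambda>c. c *\<^sub>R _"] sum.delta cong: if_cong)
      then show "\<phi> i \<in> range (lin_comb k \<phi>)" by (metis rangeI)
    qed
    show "subspace (range (lin_comb k \<phi>))"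
    proof (rule subspaceI)
      show "0 \<in> range (lin_comb k \<phi>)"
        by (rule range_eqI[of _ _ "\<lambda>_. 0"]) (simp add: lin_comb_def)
      show "x + y \<in> range (lin_comb k \<phi>)"
        if xy: "x \<in> range (lin_comb k \<phi>)" "y \<in> range (lin_comb k \<phi>)" for x y
      proof -
        obtain a b where "x = lin_comb k \<phi> a" "y = lin_comb k \<phi> b" using xy by blast
        then have "x + y = lin_comb k \<phi> (\<lambda>i. a i + b i)"
          by (simp add: lin_comb_def scaleR_add_left sum.distrib)
        then show ?thesis by blast
      qed
      show "c *\<^sub>R x \<in> range (lin_comb k \<phi>)" if "x \<in> range (lin_comb k \<phi>)" for c x
        using that by (auto simp: lin_comb_scale[symmetric])
    qed
  qed
qed

lemma lin_indep_family_Suc: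
  assumes indep: "lin_indep_family k \<phi>" and new: "\<phi> (Suc k) \<notin> span (\<phi> ` {1..k})"
  shows "lin_indep_family (Suc k) \<phi>"
  unfolding lin_indep_family_def
proof (intro allI impI ballI)
  fix a i assume a: "lin_comb (Suc k) \<phi> a = 0" and i: "i \<in> {1..Suc k}"
  have eq: "lin_comb k \<phi> a + a (Suc k) *\<^sub>R \<phi> (Suc k) = 0"
    using a by (simp add: lin_comb_def)
  have a0: "a (Suc k) = 0"
  proof (rule ccontr)
    assume nz: "a (Suc k) \<noteq> 0"
    have "a (Suc k) *\<^sub>R \<phi> (Suc k) = - lin_comb k \<phi> a" using eq by (simp add: eq_neg_iff_add_eq_0 add.commute)
    also have "\<dots> \<in> span (\<phi> ` {1..k})"
      by (rule span_neg) (unfold span_family_eq, rule rangeI)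
    finally have "(1 / a (Suc k)) *\<^sub>R (a (Suc k) *\<^sub>R \<phi> (Suc k)) \<in> span (\<phi> ` {1..k})"
      by (rule span_scale)
    then show False using nz new by simp
  qed
  then have "lin_comb k \<phi> a = 0" using eq by simp
  then have "\<forall>i\<in>{1..k}. a i = 0" using indep by (simp add: lin_indep_family_def)
  then show "a i = 0" using a0 i by (cases "i = Suc k") auto
qed

text \<open>The quotients in the supremum are bounded by \<open>\<Sum>\<parallel>\<phi> i\<parallel>\<close>. A coefficient vector of norm \<open>0\<close> has
  quotient \<open>0\<close> by convention, and its linear combination vanishes by the same bound.\<close>

lemma norm_lin_comb_le_onorm: "norm (lin_comb N \<phi> v) \<le> lin_comb_onorm N \<phi> * L2_set v {1..N}"
proof -
  have le: "norm (lin_comb N \<phi> v) \<le> (\<Sum>i=1..N. norm (\<phi> i)) * L2_set v {1..N}" for v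
  proof -
    have "norm (lin_comb N \<phi> v) \<le> (\<Sum>i=1..N. \<bar>v i\<bar> * norm (\<phi> i))"
      unfolding lin_comb_def by (rule order_trans[OF norm_sum]) simp
    also have "\<dots> \<le> (\<Sum>i=1..N. L2_set v {1..N} * norm (\<phi> i))"
    proof (intro sum_mono mult_right_mono)
      fix i assume "i \<in> {1..N}"
      then have "\<bar>v i\<bar> \<le> L2_set (\<lambda>i. \<bar>v i\<bar>) {1..N}" by (intro member_le_L2_set) auto
      then show "\<bar>v i\<bar> \<le> L2_set v {1..N}" by (simp add: L2_set_def)
    qed simp
    finally show ?thesis by (simp add: sum_distrib_left mult.commute)
  qed
  show ?thesis
  proof (cases "L2_set v {1..N} = 0")
    case True
    then show ?thesis using le[of v] by simp
  next
    case False
    then have pos: "L2_set v {1..N} > 0" using L2_set_nonneg[of v "{1..N}"] by linarith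
    have "norm (lin_comb N \<phi> w) / L2_set w {1..N} \<le> (\<Sum>i=1..N. norm (\<phi> i))" for w
    proof (cases "L2_set w {1..N} = 0")
      case True
      then show ?thesis by (simp add: sum_nonneg)
    next
      case False
      then have "L2_set w {1..N} > 0" using L2_set_nonneg[of w "{1..N}"] by linarith
      then show ?thesis using le[of w] by (simp add: divide_le_eq)
    qed
    then have "bdd_above (range (\<lambda>v. norm (lin_comb N \<phi> v) / L2_set v {1..N}))"
      by (rule bdd_aboveI2)
    then have "norm (lin_comb N \<phi> v) / L2_set v {1..N} \<le> lin_comb_onorm N \<phi>"
      unfolding lin_comb_onorm_def by (rule cSUP_upper[OF UNIV_I])
    then show ?thesis using pos by (simp add: divide_le_eq)
  qed
qed

section \<open>Reduced approximation and greedy selection\<close>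

text \<open>Since \<open>I + M \<Lambda>\<close> is injective, the images of independent elements are independent, so the
  coefficients of the projection are uniquely determined.\<close>

lemma lin_comb_coefficients:
  assumes psd: "positive_semidefinite (final_weight D o\<^sub>L gramian D \<mu>)"
    and indep: "lin_indep_family k \<phi>"
  shows "lin_comb k (\<lambda>i. system_op D \<mu> (\<phi> i)) (coefficients D k \<phi> \<mu>) =
    orth_proj (span ((\<lambda>i. system_op D \<mu> (\<phi> i)) ` {1..k})) (system_rhs D \<mu>)"
proof -
  let ?v = "\<lambda>i. system_op D \<mu> (\<phi> i)"
  let ?w = "orth_proj (span (?v ` {1..k})) (system_rhs D \<mu>)"
  let ?Q = "\<lambda>a. (\<forall>i. i \<notin> {1..k} \<longrightarrow> a i = 0) \<and> lin_comb k ?v a = ?w"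
  have "?w \<in> range (lin_comb k ?v)"
    unfolding span_family_eq[symmetric] by (rule orth_proj_in_span) simp
  then obtain a where a: "lin_comb k ?v a = ?w" by force
  then have ex: "?Q (\<lambda>i. if i \<in> {1..k} then a i else 0)"
    by (simp add: lin_comb_def)
  have uniq: "b = c" if "?Q b" "?Q c" for b c
  proof
    fix i
    have "lin_comb k ?v (\<lambda>i. b i - c i) = 0" using that by (simp add: lin_comb_diff)
    then have "lin_comb k \<phi> (\<lambda>i. b i - c i) = 0"
      using system_op_norm_lower_bound[OF psd, of "lin_comb k \<phi> (\<lambda>i. b i - c i)"]
      by (simp add: blinfun_apply_lin_comb)
    then have "\<forall>i\<in>{1..k}. b i - c i = 0" using indep unfolding lin_indep_family_def by blast
    then show "b i = c i" using that by (cases "i \<in> {1..k}") auto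
  qed
  have "?Q (coefficients D k \<phi> \<mu>)"
    unfolding coefficients_def by (rule theI[of ?Q, OF ex uniq[OF _ ex]])
  then show ?thesis by blast
qed

text \<open>Among all elements of the reduced space, the approximate adjoint has the smallest residual,
  since its image under \<open>I + M \<Lambda>\<close> is the orthogonal projection of the right-hand side onto the
  image of the reduced space.\<close>

lemma approx_adjoint_minimizes_error_estimator:
  assumes "positive_semidefinite (final_weight D o\<^sub>L gramian D \<mu>)" and "lin_indep_family k \<phi>"
  shows "error_estimator D \<mu> (approx_adjoint D k \<phi> \<mu>) \<le> error_estimator D \<mu> (lin_comb k \<phi> a)"
  unfolding error_estimator_def approx_adjoint_def blinfun_apply_lin_comb
    lin_comb_coefficients[OF assms]
  by (rule orth_proj_best_approximation) (unfold span_family_eq, simp_all)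

lemma gram_schmidt_step_notin_span:
  assumes "finite B" "p \<notin> span B"
  shows "gram_schmidt_step B p \<notin> span B"
proof
  let ?r = "p - orth_proj (span B) p"
  assume "gram_schmidt_step B p \<in> span B"
  then have "norm ?r *\<^sub>R (?r /\<^sub>R norm ?r) \<in> span B"
    unfolding gram_schmidt_step_def by (rule span_scale)
  then have "?r \<in> span B"
    using assms by (cases "?r = 0") (simp_all add: span_zero)
  from span_add[OF this orth_proj_in_span[OF assms(1), of p]] show False
    using assms(2) by simp
qed

text \<open>An adjoint lying in the current reduced space is reproduced with zero residual. As long as the
  loop runs, the residual at the selected parameter is positive, so the new element enlarges the
  space.\<close>

lemma greedy_family_lin_indep:
  assumes T: "horizon D > 0"
    and psd: "\<And>\<mu>. \<mu> \<in> Q \<Longrightarrow> positive_semidefinite (final_weight D o\<^sub>L gramian D \<mu>)"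
    and m: "\<And>k. k < N \<Longrightarrow> m (Suc k) \<in> Q"
    and pos: "\<And>k. k < N \<Longrightarrow> 0 < error_estimator D (m (Suc k)) (approx_adjoint D k \<phi> (m (Suc k)))"
    and step: "\<And>k. k < N \<Longrightarrow> \<phi> (Suc k) = final_adjoint D (m (Suc k)) \<or>
      \<phi> (Suc k) = gram_schmidt_step (\<phi> ` {1..k}) (final_adjoint D (m (Suc k)))"
  shows "k \<le> N \<Longrightarrow> lin_indep_family k \<phi>"
proof (induction k)
  case 0
  show ?case by (simp add: lin_indep_family_def)
next
  case (Suc k)
  then have k: "k < N" and indep: "lin_indep_family k \<phi>" by simp_all
  let ?\<nu> = "m (Suc k)"
  have new: "final_adjoint D ?\<nu> \<notin> span (\<phi> ` {1..k})"
  proof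
    assume "final_adjoint D ?\<nu> \<in> span (\<phi> ` {1..k})"
    then obtain a where a: "final_adjoint D ?\<nu> = lin_comb k \<phi> a"
      unfolding span_family_eq by blast
    have "error_estimator D ?\<nu> (approx_adjoint D k \<phi> ?\<nu>) \<le> error_estimator D ?\<nu> (final_adjoint D ?\<nu>)"
      unfolding a by (rule approx_adjoint_minimizes_error_estimator[OF psd[OF m[OF k]] indep])
    also have "\<dots> = 0"
      by (simp add: error_estimator_def system_op_final_adjoint[OF T psd[OF m[OF k]]])
    finally show False using pos[OF k] by simp
  qed
  have "gram_schmidt_step (\<phi> ` {1..k}) (final_adjoint D ?\<nu>) \<notin> span (\<phi> ` {1..k})"
    by (rule gram_schmidt_step_notin_span[OF _ new]) simp
  with new step[OF k] have "\<phi> (Suc k) \<notin> span (\<phi> ` {1..k})" by metis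
  with indep show ?case by (rule lin_indep_family_Suc)
qed

section \<open>The error estimate\<close>

theorem lemma2:
  fixes P :: "'p::banach set"
    and D :: "('p, 'x::{real_inner,banach}, 'u::{real_inner,banach}) lq_problem"
    and \<alpha> C \<epsilon> :: real
    and N :: nat
    and \<phi> :: "nat \<Rightarrow> 'x"
    and \<pi>' :: "'p \<Rightarrow> nat \<Rightarrow> real"
  assumes "\<exists>x::'x. x \<noteq> 0"
    and "horizon D > 0"
    and "compact P" and "P \<noteq> {}"
    and "\<exists>L. L-lipschitz_on P (state_op D)"
    and "\<exists>L. L-lipschitz_on P (control_op D)"
    and "\<exists>L. L-lipschitz_on P (init_state D)"
    and "\<exists>L. L-lipschitz_on P (target_state D)"
    and "self_adjoint (final_weight D)" and "positive_semidefinite (final_weight D)"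
    and "self_adjoint (control_weight D)"
    and "\<alpha> > 0" and "positive_semidefinite (control_weight D - \<alpha> *\<^sub>R id_blinfun)"
    and "\<And>\<mu>. \<mu> \<in> P \<Longrightarrow> positive_semidefinite (final_weight D o\<^sub>L gramian D \<mu>)"
    and "C-lipschitz_on P (final_adjoint D)"
    and "\<epsilon> > 0"
    and "greedy_basis P D C \<epsilon> N \<phi>"
    and "\<mu> \<in> P"
  shows "norm (final_adjoint D \<mu> - lin_comb N \<phi> (\<pi>' \<mu>))
    \<le> system_bound P D * \<epsilon>
      + lin_comb_onorm N \<phi> * L2_set (\<lambda>i. coefficients D N \<phi> \<mu> i - \<pi>' \<mu> i) {1..N}"
proof -
  let ?c = "system_bound P D"
  define \<gamma> where "\<gamma> = 1 / (C + ?c)"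
  have psd: "\<And>\<nu>. \<nu> \<in> P \<Longrightarrow> positive_semidefinite (final_weight D o\<^sub>L gramian D \<nu>)"
    by (fact assms(14))
  have op_le: "norm (system_op D \<nu>) \<le> ?c" if "\<nu> \<in> P" for \<nu>
    using norm_system_op_le_system_bound[OF assms(2,3,5,6) that] .
  have C: "0 \<le> C" using assms(15) by (rule lipschitz_on_nonneg)
  have c: "1 \<le> ?c"
  proof -
    obtain x :: 'x where x: "x \<noteq> 0" using assms(1) by blast
    have "norm x \<le> norm (system_op D \<mu> x)"
      by (rule system_op_norm_lower_bound[OF psd[OF assms(18)]])
    also have "\<dots> \<le> norm (system_op D \<mu>) * norm x" by (rule norm_blinfun)
    finally have "1 \<le> norm (system_op D \<mu>)" using x by simp
    then show ?thesis using op_le[OF assms(18)] by simp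
  qed
  \<comment> \<open>This identity is what the choice of \<open>\<gamma>\<close> is made for: the covering error \<open>C \<gamma> \<epsilon>\<close> and the greedy
    tolerance add up to \<open>\<epsilon>\<close>.\<close>
  have \<gamma>: "0 < \<gamma>" and \<gamma>_sum: "\<gamma> * (C + ?c) = 1" using C c by (simp_all add: \<gamma>_def)
  have tol: "0 < ?c * \<gamma> * \<epsilon>" using c \<gamma> assms(16) by simp
  have \<delta>: "?c * \<gamma> * \<epsilon> / ?c = \<gamma> * \<epsilon>" using c by simp
  obtain Q m where Q: "Q \<subseteq> P" "\<And>\<mu>. \<mu> \<in> P \<Longrightarrow> \<exists>\<nu>\<in>Q. norm (\<mu> - \<nu>) \<le> \<gamma> * \<epsilon>"
    and arg_max: "\<And>k. k \<le> N \<Longrightarrow> is_arg_max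
        (\<lambda>\<mu>. error_estimator D \<mu> (approx_adjoint D k \<phi> \<mu>)) (\<lambda>\<mu>. \<mu> \<in> Q) (m (Suc k))"
    and loop: "\<And>k. k < N \<Longrightarrow>
        ?c * \<gamma> * \<epsilon> < error_estimator D (m (Suc k)) (approx_adjoint D k \<phi> (m (Suc k)))"
    and step: "\<And>k. k < N \<Longrightarrow> \<phi> (Suc k) = final_adjoint D (m (Suc k)) \<or>
        \<phi> (Suc k) = gram_schmidt_step (\<phi> ` {1..k}) (final_adjoint D (m (Suc k)))"
    and stop: "error_estimator D (m (Suc N)) (approx_adjoint D N \<phi> (m (Suc N))) \<le> ?c * \<gamma> * \<epsilon>"
    using assms(17) unfolding greedy_basis_def Let_def \<gamma>_def[symmetric] \<delta> by blast
  have mQ: "m (Suc k) \<in> Q" if "k \<le> N" for k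
    using arg_max[OF that] by (simp add: is_arg_max_def)
  have indep: "lin_indep_family N \<phi>"
  proof (rule greedy_family_lin_indep[OF assms(2), where Q = Q and m = m])
    show "0 < error_estimator D (m (Suc k)) (approx_adjoint D k \<phi> (m (Suc k)))" if "k < N" for k
      using loop[OF that] tol by linarith
  qed (use psd Q(1) mQ step in auto)
  obtain \<nu> where \<nu>: "\<nu> \<in> Q" "norm (\<mu> - \<nu>) \<le> \<gamma> * \<epsilon>"
    using Q(2)[OF assms(18)] by blast
  then have \<nu>P: "\<nu> \<in> P" using Q(1) by blast
  let ?p = "approx_adjoint D N \<phi> \<nu>"
  have "norm (final_adjoint D \<nu> - ?p) \<le> error_estimator D \<nu> ?p"
    by (rule norm_error_le_error_estimator[OF assms(2) psd[OF \<nu>P]])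
  also have "\<dots> \<le> error_estimator D (m (Suc N)) (approx_adjoint D N \<phi> (m (Suc N)))"
    using arg_max[OF order_refl] \<nu>(1) by (auto simp: is_arg_max_def not_less)
  also note stop
  finally have near: "norm (final_adjoint D \<nu> - ?p) \<le> ?c * \<gamma> * \<epsilon>" .
  have "norm (final_adjoint D \<mu> - final_adjoint D \<nu>) \<le> C * norm (\<mu> - \<nu>)"
    using lipschitz_onD[OF assms(15,18) \<nu>P] by (simp add: dist_norm)
  also have "\<dots> \<le> C * (\<gamma> * \<epsilon>)" using \<nu>(2) C by (rule mult_left_mono)
  finally have "norm (final_adjoint D \<mu> - ?p) \<le> C * (\<gamma> * \<epsilon>) + ?c * \<gamma> * \<epsilon>"
    using near norm_triangle_ineq[of "final_adjoint D \<mu> - final_adjoint D \<nu>" "final_adjoint D \<nu> - ?p"]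
    by simp
  also have "\<dots> = \<gamma> * (C + ?c) * \<epsilon>" by (simp add: algebra_simps)
  finally have transfer: "norm (final_adjoint D \<mu> - ?p) \<le> \<epsilon>" by (simp add: \<gamma>_sum)
  have "norm (final_adjoint D \<mu> - approx_adjoint D N \<phi> \<mu>)
      \<le> error_estimator D \<mu> (approx_adjoint D N \<phi> \<mu>)"
    by (rule norm_error_le_error_estimator[OF assms(2) psd[OF assms(18)]])
  also have "\<dots> \<le> error_estimator D \<mu> ?p"
    unfolding approx_adjoint_def[of D N \<phi> \<nu>]
    by (rule approx_adjoint_minimizes_error_estimator[OF psd[OF assms(18)] indep])
  also have "\<dots> \<le> norm (system_op D \<mu>) * norm (final_adjoint D \<mu> - ?p)"
    by (rule error_estimator_le_norm_error[OF assms(2) psd[OF assms(18)]])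
  also have "\<dots> \<le> ?c * \<epsilon>"
    using op_le[OF assms(18)] transfer c by (intro mult_mono) auto
  finally have reduced: "norm (final_adjoint D \<mu> - approx_adjoint D N \<phi> \<mu>) \<le> ?c * \<epsilon>" .
  have "norm (approx_adjoint D N \<phi> \<mu> - lin_comb N \<phi> (\<pi>' \<mu>))
      \<le> lin_comb_onorm N \<phi> * L2_set (\<lambda>i. coefficients D N \<phi> \<mu> i - \<pi>' \<mu> i) {1..N}"
    unfolding approx_adjoint_def lin_comb_diff[symmetric] by (rule norm_lin_comb_le_onorm)
  with reduced show ?thesis
    using norm_triangle_ineq[of "final_adjoint D \<mu> - approx_adjoint D N \<phi> \<mu>"
        "approx_adjoint D N \<phi> \<mu> - lin_comb N \<phi> (\<pi>' \<mu>)"]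
    by simp
qed
end
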